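(* Let $\underline{\mathbf G}^{(m)}\in\mathbb R^{R_{m-1}\times I_m\times R_m}$, $m=1,\ldots,N$, with $R_0=R_N=1$, be the TT-cores of a tensor train decomposition, and let $n\in\{1,2,\ldots,N\}$ be fixed. (a) If $\underline{\mathbf G}^{(1)},\underline{\mathbf G}^{(2)},\ldots,\underline{\mathbf G}^{(n-1)}$ are left-orthogonal, then $\mathbf G^{<n}_{(n)}$ has orthonormal rows. (b) If $\underline{\mathbf G}^{(n+1)},\underline{\mathbf G}^{(n+2)},\ldots,\underline{\mathbf G}^{(N)}$ are right-orthogonal, then $\mathbf G^{>n}_{(1)}$ has orthonormal rows.
   Context: Tensors are real arrays. Multi-index: $\overline{i_1i_2\cdots i_N}=i_N+(i_{N-1}-1)I_N+\cdots+(i_1-1)I_2I_3\cdots I_N$. The mode-$n$ matricization of $\underline{\mathbf X}\in\mathbb R^{I_1\times\cdots\times I_N}$ is $\mathbf X_{(n)}\in\mathbb R^{I_n\times I_1\cdots I_{n-1}I_{n+1}\cdots I_N}$ with $(\mathbf X_{(n)})_{i_n,\overline{i_1\cdots i_{n-1}i_{n+1}\cdots i_N}}=\underline{\mathbf X}(i_1,\ldots,i_N)$. A core $\underline{\mathbf G}^{(m)}\in\mathbb R^{R_{m-1}\times I_m\times R_m}$ is left-orthogonal if $\mathbf G^{(m)}_{(3)}\mathbf G^{(m)\top}_{(3)}=\mathbf I_{R_m}$, and right-orthogonal if $\mathbf G^{(m)}_{(1)}\mathbf G^{(m)\top}_{(1)}=\mathbf I_{R_{m-1}}$, where $\mathbf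 G^{(m)}_{(k)}$ denotes the mode-$k$ matricization of $\underline{\mathbf G}^{(m)}$. Contracted product: for $\underline{\mathbf A}\in\mathbb R^{I_1\times\cdots\times I_M}$, $\underline{\mathbf B}\in\mathbb R^{J_1\times\cdots\times J_N}$ with $I_M=J_1$, $\underline{\mathbf A}\times^1\underline{\mathbf B}\in\mathbb R^{I_1\times\cdots\times I_{M-1}\times J_2\times\cdots\times J_N}$ has entries $\sum_{i_M}\underline{\mathbf A}(i_1,\ldots,i_M)\underline{\mathbf B}(i_M,j_2,\ldots,j_N)$. Define (dropping the singleton modes of size $R_0=1$, $R_N=1$) $\underline{\mathbf G}^{<n}=\underline{\mathbf G}^{(1)}\times^1\cdots\times^1\underline{\mathbf G}^{(n-1)}\in\mathbb R^{I_1\times\cdots\times I_{n-1}\times R_{n-1}}$ and $\underline{\mathbf G}^{>n}=\underline{\mathbf G}^{(n+1)}\times^1\cdots\times^1\underline{\mathbf G}^{(N)}\in\mathbb R^{R_n\times I_{n+1}\times\cdots\times I_N}$, with $\underline{\mathbf G}^{<1}=\underline{\mathbf G}^{>N}=1$. $\mathbf G^{<n}_{(n)}\in\mathbb R^{R_{n-1}\times I_1\cdots I_{n-1}}$ is the mode-$n$ (last mode) matricization of $\underline{\mathbf G}^{<n}$, and $\mathbf G^{>n}_{(1)}\in\mathbb R^{R_n\times I_{n+1}\cdots I_N}$ is the mode-$1$ matricization of $\underline{\mathbf G}^{>n}$ (both equal to $1$ in the trivial cases). A matrix $\mathbf U$ has orthonormal rows if $\mathbf U\mathbf U^\top$ is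 the identity. *)

theory Defs
  imports "Jordan_Normal_Form.Matrix"
begin

text \<open>
  A real tensor of size \<open>I\<^sub>1 \<times> \<dots> \<times> I\<^sub>N\<close> is the list \<open>[I\<^sub>1, \<dots>, I\<^sub>N]\<close> with an entry function on
  index lists; only the entries at the lists in \<open>indices [I\<^sub>1, \<dots>, I\<^sub>N]\<close> are meaningful.
  As for the type \<^typ>\<open>real mat\<close>, indices are counted from 0. Modes are counted from 1.
\<close>

datatype tensor = Tensor (dims: "nat list") (entry: "nat list \<Rightarrow> real")

definition indices :: "nat list \<Rightarrow> nat list set" where
  "indices Is = {is. length is = length Is \<and> (\<forall>k < length Is. is ! k < Is ! k)}"

text \<open>
  The multi-index \<open>i\<^sub>N + (i\<^sub>N\<^sub>-\<^sub>1 - 1) I\<^sub>N + \<dots> + (i\<^sub>1 - 1) I\<^sub>2 I\<^sub>3 \<dots> I\<^sub>N\<close>, with all indices and the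
  result shifted to start from 0.
\<close>

definition multi_index :: "nat list \<Rightarrow> nat list \<Rightarrow> nat" where
  "multi_index Is is = (\<Sum>k < length Is. is ! k * prod_list (drop (Suc k) Is))"

definition remove_mode :: "nat \<Rightarrow> nat list \<Rightarrow> nat list" where
  "remove_mode k xs = take (k - 1) xs @ drop k xs"

definition insert_mode :: "nat \<Rightarrow> nat \<Rightarrow> nat list \<Rightarrow> nat list" where
  "insert_mode k i xs = take (k - 1) xs @ i # drop (k - 1) xs"

text \<open>
  The column number is decoded by inverting the multi-index of the remaining modes; this is a
  bijection by \<open>bij_betw_multi_index\<close>, and \<open>matricization_entry\<close> is the defining equation of
  the matricization in its usual form.
\<close>

definition matricization :: "nat \<Rightarrow> tensor \<Rightarrow> real mat" where
  "matricization k X = (let Js = remove_mode k (dims X) in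
     mat (dims X ! (k - 1)) (prod_list Js)
       (\<lambda>(i, j). entry X (insert_mode k i (the_inv_into (indices Js) (multi_index Js) j))))"

definition orthonormal_rows :: "real mat \<Rightarrow> bool" where
  "orthonormal_rows U \<longleftrightarrow> U * transpose_mat U = 1\<^sub>m (dim_row U)"

definition left_orthogonal :: "tensor \<Rightarrow> bool" where
  "left_orthogonal X \<longleftrightarrow>
     matricization 3 X * transpose_mat (matricization 3 X) = 1\<^sub>m (dims X ! 2)"

definition right_orthogonal :: "tensor \<Rightarrow> bool" where
  "right_orthogonal X \<longleftrightarrow>
     matricization 1 X * transpose_mat (matricization 1 X) = 1\<^sub>m (dims X ! 0)"

text \<open>Only used when the last dimension of \<open>A\<close> equals the first dimension of \<open>B\<close>.\<close>

definition contract :: "tensor \<Rightarrow> tensor \<Rightarrow> tensor"  (infixl "\<times>\<^sup>1" 70) where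
  "A \<times>\<^sup>1 B = Tensor (butlast (dims A) @ tl (dims B))
     (\<lambda>is. let p = length (dims A) - 1 in
        \<Sum>i < last (dims A). entry A (take p is @ [i]) * entry B (i # drop p is))"

definition drop_first_mode :: "tensor \<Rightarrow> tensor" where
  "drop_first_mode X = Tensor (tl (dims X)) (\<lambda>is. entry X (0 # is))"

definition drop_last_mode :: "tensor \<Rightarrow> tensor" where
  "drop_last_mode X = Tensor (butlast (dims X)) (\<lambda>is. entry X (is @ [0]))"

text \<open>
  The trivial value \<open>1\<close> of \<open>cores_before\<close> and \<open>cores_after\<close> has the single mode
  \<open>R\<^sub>0 = 1\<close> or \<open>R\<^sub>N = 1\<close>, so that its mode-1 matricization is the \<open>1 \<times> 1\<close> matrix \<open>1\<close>.
\<close>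

definition one_tensor :: tensor where
  "one_tensor = Tensor [1] (\<lambda>_. 1)"

text \<open>\<open>G m\<close> is the \<open>m\<close>-th core. The singleton modes dropped are those of size \<open>R\<^sub>0\<close> and \<open>R\<^sub>N\<close>.\<close>

definition cores_before :: "(nat \<Rightarrow> tensor) \<Rightarrow> nat \<Rightarrow> tensor" where
  "cores_before G n =
     (if n = 1 then one_tensor
      else drop_first_mode (foldl (\<times>\<^sup>1) (G 1) (map G [2..<n])))"

definition cores_after :: "(nat \<Rightarrow> tensor) \<Rightarrow> nat \<Rightarrow> nat \<Rightarrow> tensor" where
  "cores_after G N n =
     (if n = N then one_tensor
      else drop_last_mode (foldl (\<times>\<^sup>1) (G (n + 1)) (map G [n + 2..<N + 1])))"

lemma multi_index_Cons:
  "multi_index (d # Is) (i # is) = i * prod_list Is + multi_index Is is"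
  by (simp add: multi_index_def sum.lessThan_Suc_shift del: sum.lessThan_Suc)

lemma indices_Cons: "indices (d # Is) = (\<lambda>(i, is). i # is) ` ({..<d} \<times> indices Is)"
proof (intro equalityI subsetI)
  fix js assume "js \<in> indices (d # Is)"
  then have l: "length js = Suc (length Is)"
    and b: "\<And>k. k < Suc (length Is) \<Longrightarrow> js ! k < (d # Is) ! k"
    by (auto simp: indices_def)
  then obtain i "is" where js: "js = i # is" by (cases js) auto
  have "i < d" using b[of 0] js by simp
  moreover have "is \<in> indices Is"
    using l b[of "Suc _"] js by (simp add: indices_def)
  ultimately show "js \<in> (\<lambda>(i, is). i # is) ` ({..<d} \<times> indices Is)" using js by auto
qed (auto simp: indices_def nth_Cons split: nat.split)

lemma bij_betw_multi_index:
  "bij_betw (multi_index Is) (indices Is) {..<prod_list Is}"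
proof (induction Is)
  case Nil
  show ?case by (simp add: indices_def multi_index_def bij_betw_def lessThan_Suc)
next
  case (Cons d Is)
  let ?P = "prod_list Is"
  have inj: "inj_on (multi_index Is) (indices Is)"
    and img: "multi_index Is ` indices Is = {..<?P}"
    using Cons by (auto simp: bij_betw_def)
  have lt: "multi_index Is is < ?P" if "is \<in> indices Is" for "is"
    using img that by blast
  have "inj_on (multi_index (d # Is)) (indices (d # Is))"
  proof (rule inj_onI)
    fix x y assume "x \<in> indices (d # Is)" "y \<in> indices (d # Is)"
      and eq: "multi_index (d # Is) x = multi_index (d # Is) y"
    then obtain i "is" j js where xy: "x = i # is" "y = j # js"
      and mem: "is \<in> indices Is" "js \<in> indices Is"
      by (auto simp: indices_Cons)
    have e: "i * ?P + multi_index Is is = j * ?P + multi_index Is js"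
      using eq by (simp add: xy multi_index_Cons)
    have "i = j"
      using arg_cong[OF e, of "\<lambda>t. t div ?P"] lt[OF mem(1)] lt[OF mem(2)] by simp
    moreover from this have "is = js" using e inj mem by (auto dest: inj_onD)
    ultimately show "x = y" by (simp add: xy)
  qed
  moreover have "multi_index (d # Is) ` indices (d # Is) = {..<d * ?P}"
  proof (intro equalityI subsetI)
    fix t assume "t \<in> multi_index (d # Is) ` indices (d # Is)"
    then obtain i "is" where t: "t = i * ?P + multi_index Is is" "i < d" "is \<in> indices Is"
      by (auto simp: indices_Cons multi_index_Cons)
    have "t < Suc i * ?P" using t lt by simp
    also have "\<dots> \<le> d * ?P" using t by (intro mult_right_mono) auto
    finally show "t \<in> {..<d * ?P}" by simp
  next
    fix t assume t: "t \<in> {..<d * ?P}"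
    then have P: "?P > 0" by (cases "?P = 0") auto
    have "t mod ?P \<in> multi_index Is ` indices Is" using img P by simp
    then obtain "is" where is1: "is \<in> indices Is" "multi_index Is is = t mod ?P" by auto
    have "t div ?P < d" using t by (simp add: less_mult_imp_div_less)
    then have "(t div ?P) # is \<in> indices (d # Is)" using is1 by (auto simp: indices_Cons)
    moreover have "multi_index (d # Is) ((t div ?P) # is) = t"
      using is1 by (simp add: multi_index_Cons)
    ultimately show "t \<in> multi_index (d # Is) ` indices (d # Is)" by force
  qed
  ultimately show ?case by (simp add: bij_betw_def)
qed

lemma remove_mode_indices:
  assumes "1 \<le> k" "k \<le> length Is" "is \<in> indices Is"
  shows "remove_mode k is \<in> indices (remove_mode k Is)"
  using assms by (auto simp: remove_mode_def indices_def nth_append min_def)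

lemma insert_remove_mode:
  assumes "1 \<le> k" "k \<le> length is"
  shows "insert_mode k (is ! (k - 1)) (remove_mode k is) = is"
  using assms id_take_nth_drop[of "k - 1" "is"]
  by (simp add: insert_mode_def remove_mode_def less_le_trans[of "k - 1" k])

lemma matricization_entry:
  assumes k: "1 \<le> k" "k \<le> length (dims X)" and "is": "is \<in> indices (dims X)"
  shows "matricization k X $$
      (is ! (k - 1), multi_index (remove_mode k (dims X)) (remove_mode k is)) = entry X is"
proof -
  let ?Js = "remove_mode k (dims X)"
  have mem: "remove_mode k is \<in> indices ?Js" by (rule remove_mode_indices[OF k "is"])
  have "multi_index ?Js (remove_mode k is) < prod_list ?Js"
    using bij_betw_multi_index[of ?Js] mem by (auto simp: bij_betw_def)
  moreover have "is ! (k - 1) < dims X ! (k - 1)" "length is = length (dims X)"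
    using k "is" by (auto simp: indices_def)
  moreover have
    "the_inv_into (indices ?Js) (multi_index ?Js) (multi_index ?Js (remove_mode k is))
      = remove_mode k is"
    using bij_betw_multi_index[of ?Js] mem by (intro the_inv_into_f_f) (auto simp: bij_betw_def)
  ultimately show ?thesis
    using k insert_remove_mode[of k "is"] by (simp add: matricization_def Let_def)
qed

end

theory Submission
  imports Defs
begin

text \<open>
  Contracting two tensors preserves orthonormality of the slices along the first mode, and of those
  along the last mode: in the Gram matrix of the product, the sum over the free indices of one factor
  collapses to a Kronecker delta on the contracted index, which leaves the Gram matrix of the other
  factor. Hence both parts follow by induction on the number of cores, with the same left-nested
  product of cores.
\<close>

section \<open>Orthonormal families of real functions\<close>

definition orthonormal_on :: "'a set \<Rightarrow> nat \<Rightarrow> (nat \<Rightarrow> 'a \<Rightarrow> real) \<Rightarrow> bool" where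
  "orthonormal_on V r g \<longleftrightarrow> (\<forall>a<r. \<forall>b<r. (\<Sum>v\<in>V. g a v * g b v) = of_bool (a = b))"

lemma orthonormal_onD:
  "orthonormal_on V r g \<Longrightarrow> a < r \<Longrightarrow> b < r \<Longrightarrow> (\<Sum>v\<in>V. g a v * g b v) = of_bool (a = b)"
  by (simp add: orthonormal_on_def)

lemma orthonormal_on_cong:
  assumes "V = W" "r = s" "\<And>a v. a < s \<Longrightarrow> v \<in> W \<Longrightarrow> f a v = g a v"
  shows "orthonormal_on V r f \<longleftrightarrow> orthonormal_on W s g"
  using assms by (simp add: orthonormal_on_def)

text \<open>Parseval's identity: the inner product of two combinations of an orthonormal family is
  that of their coefficients. In a contraction, \<open>V\<close> holds the free indices of one
  factor and \<open>l\<close> is the contracted index.\<close>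

lemma sum_orthonormal_combination:
  assumes "orthonormal_on V r g"
  shows "(\<Sum>v\<in>V. (\<Sum>l<r. x l * g l v) * (\<Sum>l<r. y l * g l v)) = (\<Sum>l<r. x l * y l)"
proof -
  have "(\<Sum>v\<in>V. (\<Sum>l<r. x l * g l v) * (\<Sum>l<r. y l * g l v))
      = (\<Sum>v\<in>V. \<Sum>l<r. \<Sum>k<r. x l * y k * (g l v * g k v))"
    by (simp add: sum_product mult_ac)
  \<comment> \<open>Fixing \<open>A = V\<close> only ever moves the sum over \<open>V\<close>
    inwards, so the rewriting stops once it is innermost.\<close>
  also have "\<dots> = (\<Sum>l<r. \<Sum>k<r. \<Sum>v\<in>V. x l * y k * (g l v * g k v))"
    by (simp only: sum.swap[where A = V])
  also have "\<dots> = (\<Sum>l<r. \<Sum>k<r. x l * y k * of_bool (l = k))"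
    using assms by (simp add: orthonormal_onD flip: sum_distrib_left)
  also have "\<dots> = (\<Sum>l<r. x l * y l)"
    by (simp add: of_bool_def if_distrib cong: if_cong)
  finally show ?thesis .
qed

section \<open>Sums over index lists and Gram matrices of matricizations\<close>

lemma length_indices: "is \<in> indices Is \<Longrightarrow> length is = length Is"
  by (simp add: indices_def)

lemma indices_singleton: "indices [d] = (\<lambda>i. [i]) ` {..<d}"
proof -
  have "indices [] = {[]}" by (auto simp: indices_def)
  then show ?thesis by (auto simp: indices_Cons)
qed

text \<open>Cutting a list at position \<open>length Is\<close> inverts concatenation. This
  separates the free indices of the two factors of a contraction.\<close>

lemma sum_indices_append:
  "sum f (indices (Is @ Js)) = (\<Sum>is\<in>indices Is. \<Sum>js\<in>indices Js. f (is @ js))"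
proof -
  have "bij_betw (\<lambda>(is, js). is @ js) (indices Is \<times> indices Js) (indices (Is @ Js))"
  proof (rule bij_betw_byWitness[where f' = "\<lambda>ks. (take (length Is) ks, drop (length Is) ks)"])
    show "(\<lambda>ks. (take (length Is) ks, drop (length Is) ks)) ` indices (Is @ Js)
        \<subseteq> indices Is \<times> indices Js"
    proof clarify
      fix ks assume ks: "ks \<in> indices (Is @ Js)"
      have "ks ! k < Is ! k" if "k < length Is" for k
        using ks that by (auto simp: indices_def nth_append dest!: spec[of _ k])
      moreover have "ks ! (length Is + k) < Js ! k" if "k < length Js" for k
        using ks that by (auto simp: indices_def nth_append dest!: spec[of _ "length Is + k"])
      ultimately show "take (length Is) ks \<in> indices Is \<and> drop (length Is) ks \<in> indices Js"
        using ks by (auto simp: indices_def)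
    qed
  qed (auto simp: indices_def nth_append)
  from sum.reindex_bij_betw[OF this, of f] show ?thesis
    by (simp add: sum.cartesian_product case_prod_unfold)
qed

lemma sum_indices_singleton: "sum f (indices [d]) = (\<Sum>i<d. f [i])"
  by (simp add: indices_singleton sum.reindex inj_on_def)

lemma sum_indices_Cons:
  "sum f (indices (d # Is)) = (\<Sum>i<d. \<Sum>is\<in>indices Is. f (i # is))"
  using sum_indices_append[of f "[d]" Is] by (simp add: sum_indices_singleton)

lemma sum_indices_snoc:
  "sum f (indices (Is @ [d])) = (\<Sum>is\<in>indices Is. \<Sum>i<d. f (is @ [i]))"
  by (simp add: sum_indices_append sum_indices_singleton)

text \<open>Since \<open>multi_index\<close> is a bijection onto the column numbers, the sum over
  columns in the Gram matrix becomes a sum over index lists and the decoding cancels. From here on,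
  column numbers no longer occur.\<close>

lemma orthonormal_rows_matricization_iff:
  "orthonormal_rows (matricization k X) \<longleftrightarrow>
    orthonormal_on (indices (remove_mode k (dims X))) (dims X ! (k - 1))
      (\<lambda>a is. entry X (insert_mode k a is))"
proof -
  define Js where "Js = remove_mode k (dims X)"
  define M where "M = matricization k X"
  have row: "dim_row M = dims X ! (k - 1)" and col: "dim_col M = prod_list Js"
    by (simp_all add: M_def Js_def matricization_def Let_def)
  have "(M * transpose_mat M) $$ (a, b)
      = (\<Sum>is\<in>indices Js. entry X (insert_mode k a is) * entry X (insert_mode k b is))"
    if "a < dim_row M" "b < dim_row M" for a b
  proof -
    let ?e = "\<lambda>a j. entry X (insert_mode k a (the_inv_into (indices Js) (multi_index Js) j))"
    have inj: "inj_on (multi_index Js) (indices Js)"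
      using bij_betw_multi_index by (rule bij_betw_imp_inj_on)
    have "(M * transpose_mat M) $$ (a, b) = (\<Sum>j<prod_list Js. M $$ (a, j) * M $$ (b, j))"
      using that by (simp add: scalar_prod_def col lessThan_atLeast0)
    also have "\<dots> = (\<Sum>j<prod_list Js. ?e a j * ?e b j)"
      using that unfolding row by (simp add: M_def Js_def matricization_def Let_def)
    also have "\<dots> = (\<Sum>is\<in>indices Js. ?e a (multi_index Js is) * ?e b (multi_index Js is))"
      by (rule sum.reindex_bij_betw[OF bij_betw_multi_index, symmetric])
    also have "\<dots> = (\<Sum>is\<in>indices Js. entry X (insert_mode k a is) * entry X (insert_mode k b is))"
      by (simp add: the_inv_into_f_f[OF inj])
    finally show ?thesis .
  qed
  then show ?thesis
    unfolding orthonormal_rows_def orthonormal_on_def mat_eq_iff Js_def[symmetric]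
      M_def[symmetric] row[symmetric]
    by (simp add: of_bool_def)
qed

section \<open>Orthonormality in the first and in the last mode\<close>

definition orthonormal_first_mode :: "tensor \<Rightarrow> bool" where
  "orthonormal_first_mode X \<longleftrightarrow>
    orthonormal_on (indices (tl (dims X))) (hd (dims X)) (\<lambda>a is. entry X (a # is))"

text \<open>Stated without a mode number, because the order of a partial product grows with each
  core.\<close>

definition orthonormal_last_mode :: "tensor \<Rightarrow> bool" where
  "orthonormal_last_mode X \<longleftrightarrow>
    orthonormal_on (indices (butlast (dims X))) (last (dims X)) (\<lambda>a is. entry X (is @ [a]))"

lemma orthonormal_rows_matricization_first:
  assumes "dims X \<noteq> []"
  shows "orthonormal_rows (matricization 1 X) \<longleftrightarrow> orthonormal_first_mode X"
  using assms
  by (simp add: orthonormal_rows_matricization_iff orthonormal_first_mode_def remove_mode_def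
      insert_mode_def hd_conv_nth drop_Suc)

text \<open>Every index list of the other modes has length \<open>length ds\<close>, so inserting at
  the last mode is appending. The congruence rule supplies that membership.\<close>

lemma orthonormal_rows_matricization_last:
  assumes "dims X = ds @ [r]"
  shows "orthonormal_rows (matricization (Suc (length ds)) X) \<longleftrightarrow> orthonormal_last_mode X"
  unfolding orthonormal_rows_matricization_iff orthonormal_last_mode_def
  by (simp add: assms remove_mode_def insert_mode_def length_indices cong: orthonormal_on_cong)

lemma left_orthogonal_iff:
  assumes "dims X = [p, q, r]"
  shows "left_orthogonal X \<longleftrightarrow> orthonormal_last_mode X"
proof -
  have "left_orthogonal X \<longleftrightarrow> orthonormal_rows (matricization 3 X)"
    by (simp add: left_orthogonal_def orthonormal_rows_def matricization_def Let_def)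
  then show ?thesis
    using orthonormal_rows_matricization_last[of X "[p, q]" r] assms
    by (simp add: numeral_3_eq_3)
qed

lemma right_orthogonal_iff:
  assumes "dims X \<noteq> []"
  shows "right_orthogonal X \<longleftrightarrow> orthonormal_first_mode X"
proof -
  have "right_orthogonal X \<longleftrightarrow> orthonormal_rows (matricization 1 X)"
    by (simp add: right_orthogonal_def orthonormal_rows_def matricization_def Let_def)
  then show ?thesis
    using orthonormal_rows_matricization_first[OF assms] by simp
qed

section \<open>Contraction and removal of singleton modes\<close>

lemma dims_contract: "dims (A \<times>\<^sup>1 B) = butlast (dims A) @ tl (dims B)"
  by (simp add: contract_def)

lemma entry_contract_append:
  assumes "length is = length (dims A) - 1"
  shows "entry (A \<times>\<^sup>1 B) (is @ js)
    = (\<Sum>l<last (dims A). entry A (is @ [l]) * entry B (l # js))"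
  using assms by (simp add: contract_def Let_def)

text \<open>For fixed free indices of \<open>A\<close>, the product is a combination of the slices
  of \<open>B\<close> with coefficients from \<open>A\<close>. Summing over \<open>js\<close>
  therefore leaves a sum over \<open>is\<close> and \<open>l\<close>, that is, over all modes of
  \<open>A\<close> but the first.\<close>

lemma orthonormal_first_mode_contract:
  assumes A: "dims A = p # ds @ [r]" and B: "dims B = r # es"
    and orthA: "orthonormal_first_mode A" and orthB: "orthonormal_first_mode B"
  shows "orthonormal_first_mode (A \<times>\<^sup>1 B)"
proof -
  have "(\<Sum>is\<in>indices (ds @ es). entry (A \<times>\<^sup>1 B) (a # is) * entry (A \<times>\<^sup>1 B) (b # is))
      = of_bool (a = b)" if "a < p" "b < p" for a b
  proof -
    have e: "entry (A \<times>\<^sup>1 B) (c # is @ js)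
        = (\<Sum>l<r. entry A (c # is @ [l]) * entry B (l # js))" if "is \<in> indices ds" for c "is" js
      using entry_contract_append[of "c # is" A B js] that by (simp add: A length_indices)
    have "(\<Sum>is\<in>indices (ds @ es). entry (A \<times>\<^sup>1 B) (a # is) * entry (A \<times>\<^sup>1 B) (b # is))
        = (\<Sum>is\<in>indices ds. \<Sum>js\<in>indices es.
            (\<Sum>l<r. entry A (a # is @ [l]) * entry B (l # js)) *
            (\<Sum>l<r. entry A (b # is @ [l]) * entry B (l # js)))"
      by (simp add: sum_indices_append e)
    also have "\<dots> = (\<Sum>is\<in>indices ds. \<Sum>l<r. entry A (a # is @ [l]) * entry A (b # is @ [l]))"
      using orthB by (simp add: sum_orthonormal_combination orthonormal_first_mode_def B)
    also have "\<dots> = (\<Sum>is\<in>indices (ds @ [r]). entry A (a # is) * entry A (b # is))"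
      by (simp add: sum_indices_snoc)
    also have "\<dots> = of_bool (a = b)"
      using orthA that by (simp add: orthonormal_first_mode_def orthonormal_on_def A)
    finally show ?thesis .
  qed
  then show ?thesis
    by (simp add: orthonormal_first_mode_def orthonormal_on_def dims_contract A B)
qed

text \<open>The mirror image: \<open>B\<close> gives the coefficients and the slices of
  \<open>A\<close> along its last mode are the orthonormal family.\<close>

lemma orthonormal_last_mode_contract:
  assumes A: "dims A = ds @ [r]" and B: "dims B = r # es @ [s]"
    and orthA: "orthonormal_last_mode A" and orthB: "orthonormal_last_mode B"
  shows "orthonormal_last_mode (A \<times>\<^sup>1 B)"
proof -
  have "(\<Sum>is\<in>indices (ds @ es). entry (A \<times>\<^sup>1 B) (is @ [a]) * entry (A \<times>\<^sup>1 B) (is @ [b]))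
      = of_bool (a = b)" if "a < s" "b < s" for a b
  proof -
    \<comment> \<open>The factors are commuted so that the coefficient comes first, as in
      \<open>sum_orthonormal_combination\<close>.\<close>
    have e: "entry (A \<times>\<^sup>1 B) (is @ js @ [c])
        = (\<Sum>l<r. entry B (l # js @ [c]) * entry A (is @ [l]))" if "is \<in> indices ds" for c "is" js
      using entry_contract_append[of "is" A B "js @ [c]"] that
      by (simp add: A length_indices mult.commute)
    have "(\<Sum>is\<in>indices (ds @ es). entry (A \<times>\<^sup>1 B) (is @ [a]) * entry (A \<times>\<^sup>1 B) (is @ [b]))
        = (\<Sum>is\<in>indices ds. \<Sum>js\<in>indices es.
            (\<Sum>l<r. entry B (l # js @ [a]) * entry A (is @ [l])) *
            (\<Sum>l<r. entry B (l # js @ [b]) * entry A (is @ [l])))"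
      by (simp add: sum_indices_append e)
    \<comment> \<open>The free indices of \<open>A\<close> must be summed innermost before they can
      collapse.\<close>
    also have "\<dots> = (\<Sum>js\<in>indices es. \<Sum>is\<in>indices ds.
            (\<Sum>l<r. entry B (l # js @ [a]) * entry A (is @ [l])) *
            (\<Sum>l<r. entry B (l # js @ [b]) * entry A (is @ [l])))"
      by (rule sum.swap)
    also have "\<dots> = (\<Sum>js\<in>indices es. \<Sum>l<r. entry B (l # js @ [a]) * entry B (l # js @ [b]))"
      using orthA by (simp add: sum_orthonormal_combination orthonormal_last_mode_def A)
    also have "\<dots> = (\<Sum>l<r. \<Sum>js\<in>indices es. entry B (l # js @ [a]) * entry B (l # js @ [b]))"
      by (rule sum.swap)
    also have "\<dots> = (\<Sum>js\<in>indices (r # es). entry B (js @ [a]) * entry B (js @ [b]))"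
      by (simp add: sum_indices_Cons)
    also have "\<dots> = of_bool (a = b)"
      using orthB that by (simp add: orthonormal_last_mode_def orthonormal_on_def B)
    finally show ?thesis .
  qed
  then show ?thesis
    by (simp add: orthonormal_last_mode_def orthonormal_on_def dims_contract A B butlast_append)
qed

text \<open>A mode of size 1 has the single index 0, so removing it leaves every Gram sum
  unchanged.\<close>

lemma orthonormal_last_mode_drop_first_mode:
  assumes "dims X = 1 # ds @ [r]" "orthonormal_last_mode X"
  shows "orthonormal_last_mode (drop_first_mode X)"
  using assms
  by (simp add: orthonormal_last_mode_def orthonormal_on_def drop_first_mode_def sum_indices_Cons)

lemma orthonormal_first_mode_drop_last_mode:
  assumes "dims X = p # ds @ [1]" "orthonormal_first_mode X"
  shows "orthonormal_first_mode (drop_last_mode X)"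
  using assms
  by (simp add: orthonormal_first_mode_def orthonormal_on_def drop_last_mode_def sum_indices_snoc)

lemma orthonormal_first_mode_one_tensor: "orthonormal_first_mode one_tensor"
  by (simp add: orthonormal_first_mode_def orthonormal_on_def one_tensor_def indices_def)

section \<open>Products of consecutive cores\<close>

locale tt_cores =
  fixes G :: "nat \<Rightarrow> tensor" and R I :: "nat \<Rightarrow> nat" and j k :: nat
  assumes dims_core: "m \<in> {j..k} \<Longrightarrow> dims (G m) = [R (m - 1), I m, R m]"
    and nonempty: "j \<le> k"
begin

text \<open>The product of the cores from \<open>j\<close> to \<open>m\<close>, for
  \<open>j \<le> m\<close>, with both boundary modes kept. Dropping singleton modes only at the end
  gives every factor the shape that the contraction lemmas expect.\<close>

abbreviation chain :: "nat \<Rightarrow> tensor" where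
  "chain m \<equiv> foldl (\<times>\<^sup>1) (G j) (map G [Suc j..<Suc m])"

lemma chain_Suc: "j \<le> m \<Longrightarrow> chain (Suc m) = chain m \<times>\<^sup>1 G (Suc m)"
  by simp

lemma dims_chain:
  assumes "j \<le> m" "m \<le> k"
  shows "dims (chain m) = R (j - 1) # map I [j..<Suc m] @ [R m]"
  using assms
proof (induction m rule: dec_induct)
  case base
  then show ?case by (simp add: dims_core)
next
  case (step m)
  then show ?case
    unfolding chain_Suc[OF step.hyps(1)] by (simp add: dims_contract dims_core butlast_append)
qed

lemma orthonormal_last_mode_chain:
  assumes "\<forall>m\<in>{j..k}. left_orthogonal (G m)" "j \<le> m" "m \<le> k"
  shows "orthonormal_last_mode (chain m)"
  using assms(2,3)
proof (induction m rule: dec_induct)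
  case base
  then show ?case using assms(1) left_orthogonal_iff[OF dims_core, of j] by simp
next
  case (step m)
  have "orthonormal_last_mode (G (Suc m))"
    using step assms(1) left_orthogonal_iff[OF dims_core, of "Suc m"] by simp
  then show ?case
    unfolding chain_Suc[OF step.hyps(1)] using step
    by (intro orthonormal_last_mode_contract[where ds = "R (j - 1) # map I [j..<Suc m]"
          and r = "R m" and es = "[I (Suc m)]" and s = "R (Suc m)"])
      (simp_all only: dims_chain, simp_all add: dims_core)
qed

text \<open>Cores can be appended on the right here too: the new core collapses and leaves the Gram
  matrix of the shorter chain. Hence no reassociation of the product is needed.\<close>

lemma orthonormal_first_mode_chain:
  assumes "\<forall>m\<in>{j..k}. right_orthogonal (G m)" "j \<le> m" "m \<le> k"
  shows "orthonormal_first_mode (chain m)"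
  using assms(2,3)
proof (induction m rule: dec_induct)
  case base
  then show ?case using assms(1) right_orthogonal_iff[of "G j"] by (simp add: dims_core)
next
  case (step m)
  have "orthonormal_first_mode (G (Suc m))"
    using step assms(1) right_orthogonal_iff[of "G (Suc m)"] by (simp add: dims_core)
  then show ?case
    unfolding chain_Suc[OF step.hyps(1)] using step
    by (intro orthonormal_first_mode_contract[where p = "R (j - 1)" and ds = "map I [j..<Suc m]"
          and r = "R m" and es = "[I (Suc m), R (Suc m)]"])
      (simp_all only: dims_chain, simp_all add: dims_core)
qed

end

theorem proposition3p2:
  fixes G :: "nat \<Rightarrow> tensor" and R I :: "nat \<Rightarrow> nat" and N n :: nat
  assumes cores: "\<And>m. m \<in> {1..N} \<Longrightarrow> dims (G m) = [R (m - 1), I m, R m]"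
    and boundary: "R 0 = 1" "R N = 1"
    and n: "n \<in> {1..N}"
  shows "((\<forall>m \<in> {1..n - 1}. left_orthogonal (G m)) \<longrightarrow>
            orthonormal_rows (matricization n (cores_before G n))) \<and>
         ((\<forall>m \<in> {n + 1..N}. right_orthogonal (G m)) \<longrightarrow>
            orthonormal_rows (matricization 1 (cores_after G N n)))"
proof (intro conjI impI)
  assume left: "\<forall>m \<in> {1..n - 1}. left_orthogonal (G m)"
  show "orthonormal_rows (matricization n (cores_before G n))"
  proof (cases "n = 1")
    case True
    \<comment> \<open>The only mode of \<open>one_tensor\<close> is both its first and its last, so
      the first-mode criterion applies.\<close>
    have "orthonormal_rows (matricization 1 one_tensor)"
      by (subst orthonormal_rows_matricization_first)
        (simp_all only: orthonormal_first_mode_one_tensor, simp add: one_tensor_def)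
    then show ?thesis using True by (simp add: cores_before_def)
  next
    case False
    interpret tt_cores G R I 1 "n - 1"
      using n False by unfold_locales (rule cores, auto)
    have before: "cores_before G n = drop_first_mode (chain (n - 1))"
      using n False by (simp add: cores_before_def numeral_2_eq_2)
    \<comment> \<open>The leading 1 is \<open>R 0\<close>, the mode that is about to be
      dropped.\<close>
    have dims: "dims (chain (n - 1)) = 1 # map I [1..<n] @ [R (n - 1)]"
      using n nonempty dims_chain[of "n - 1"] boundary by simp
    have "orthonormal_last_mode (cores_before G n)"
      unfolding before
      by (rule orthonormal_last_mode_drop_first_mode
          [OF dims orthonormal_last_mode_chain[OF left nonempty order_refl]])
    \<comment> \<open>There are \<open>n - 1\<close> sizes before \<open>R (n - 1)\<close>, so the
      last mode is mode \<open>n\<close>.\<close>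
    moreover have "dims (cores_before G n) = map I [1..<n] @ [R (n - 1)]"
      unfolding before drop_first_mode_def dims by simp
    ultimately show ?thesis
      using n orthonormal_rows_matricization_last[of "cores_before G n"] by simp
  qed
next
  assume right: "\<forall>m \<in> {n + 1..N}. right_orthogonal (G m)"
  show "orthonormal_rows (matricization 1 (cores_after G N n))"
  proof (cases "n = N")
    case True
    then show ?thesis
      by (subst orthonormal_rows_matricization_first)
        (simp_all add: cores_after_def orthonormal_first_mode_one_tensor, simp add: one_tensor_def)
  next
    case False
    interpret tt_cores G R I "n + 1" N
      using n False by unfold_locales (rule cores, auto)
    have after: "cores_after G N n = drop_last_mode (chain N)"
      using False by (simp add: cores_after_def)
    \<comment> \<open>The chain starts at core \<open>n + 1\<close>, whose first mode has size
      \<open>R n\<close>; the final 1 is \<open>R N\<close>.\<close>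
    have dims: "dims (chain N) = R n # map I [n + 1..<Suc N] @ [1]"
      using nonempty dims_chain[of N] boundary by simp
    have "orthonormal_first_mode (cores_after G N n)"
      unfolding after
      by (rule orthonormal_first_mode_drop_last_mode
          [OF dims orthonormal_first_mode_chain[OF right nonempty order_refl]])
    moreover have "dims (cores_after G N n) \<noteq> []"
      unfolding after drop_last_mode_def dims by simp
    ultimately show ?thesis
      using orthonormal_rows_matricization_first by blast
  qed
qed

end
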